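(* Let $m\ge 1$ and let $k_1,\dots,k_m$ and $n_1,\dots,n_m$ be positive integers (repetitions allowed). Let $$M=\bigoplus_{i=1}^m I_{k_i}\otimes M_{n_i}(\mathbb{C})\subseteq M_d(\mathbb{C}),\qquad d=\sum_{i=1}^m k_in_i .$$ Then there exists a basis of $M$ (as a complex vector space) consisting entirely of unitary matrices that are pairwise orthogonal under the normalized trace inner product if and only if there exists a constant $c$ such that $n_i=c\,k_i$ for all $1\le i\le m$.
   Context: $M_n(\mathbb{C})$ denotes the algebra of complex $n\times n$ matrices and $I_n$ the $n\times n$ identity matrix. $\bigoplus_{i=1}^m I_{k_i}\otimes M_{n_i}(\mathbb{C})$ denotes the unital $*$-subalgebra of $M_d(\mathbb{C})$ consisting of all block-diagonal matrices $\bigoplus_{i=1}^m (I_{k_i}\otimes x_i)$ with $x_i\in M_{n_i}(\mathbb{C})$, where $\otimes$ is the Kronecker product. The normalized trace on $M_d(\mathbb{C})$ is $\tau(A)=\frac1d\operatorname{tr}(A)$, and the normalized trace inner product on $M$ is $\langle A,B\rangle=\tau(AB^* )$. The constant $c$ is a number, not required to be an integer. *)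

theory Defs
  imports "Jordan_Normal_Form.Schur_Decomposition"
begin

definition kron :: "'a::times mat \<Rightarrow> 'a mat \<Rightarrow> 'a mat" where
  "kron A B = mat (dim_row A * dim_row B) (dim_col A * dim_col B)
     (\<lambda>(i, j). A $$ (i div dim_row B, j div dim_col B) * B $$ (i mod dim_row B, j mod dim_col B))"

text \<open>The index \<open>i\<close> of the summands runs over \<open>0, \<dots>, m - 1\<close>.\<close>

definition block_algebra :: "nat \<Rightarrow> (nat \<Rightarrow> nat) \<Rightarrow> (nat \<Rightarrow> nat) \<Rightarrow> complex mat set" where
  "block_algebra m k n =
     {diag_block_mat (map (\<lambda>i. kron (1\<^sub>m (k i)) (x i)) [0..<m]) | x.
        \<forall>i<m. x i \<in> carrier_mat (n i) (n i)}"

definition block_dim :: "nat \<Rightarrow> (nat \<Rightarrow> nat) \<Rightarrow> (nat \<Rightarrow> nat) \<Rightarrow> nat" where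
  "block_dim m k n = (\<Sum>i<m. k i * n i)"

definition block_space :: "nat \<Rightarrow> (nat \<Rightarrow> nat) \<Rightarrow> (nat \<Rightarrow> nat) \<Rightarrow> (complex, complex mat) module" where
  "block_space m k n =
     (module_mat TYPE(complex) (block_dim m k n) (block_dim m k n))
       \<lparr>carrier := block_algebra m k n\<rparr>"

definition mat_trace :: "'a::comm_monoid_add mat \<Rightarrow> 'a" where
  "mat_trace A = (\<Sum>i<dim_row A. A $$ (i, i))"

definition ntrace :: "complex mat \<Rightarrow> complex" where
  "ntrace A = mat_trace A / of_nat (dim_row A)"

definition ntrace_inner :: "complex mat \<Rightarrow> complex mat \<Rightarrow> complex" where
  "ntrace_inner A B = ntrace (A * mat_adjoint B)"

definition unitary_mat :: "complex mat \<Rightarrow> bool" where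
  "unitary_mat U \<longleftrightarrow> square_mat U \<and> inverts_mat U (mat_adjoint U) \<and> inverts_mat (mat_adjoint U) U"

lemma dim_kron [simp]:
  "dim_row (kron A B) = dim_row A * dim_row B"
  "dim_col (kron A B) = dim_col A * dim_col B"
  by (simp_all add: kron_def)

lemma index_div_mod_less:
  fixes i :: nat
  assumes "i < a * b"
  shows "i div b < a" "i mod b < b"
proof -
  show "i div b < a" using assms by (simp add: less_mult_imp_div_less)
  have "b > 0" using assms by (cases b) auto
  then show "i mod b < b" by simp
qed

lemma kron_add_right:
  fixes A B C :: "'a::semiring_0 mat"
  assumes "B \<in> carrier_mat r c" "C \<in> carrier_mat r c"
  shows "kron A (B + C) = kron A B + kron A C"
  using assms by (intro eq_matI) (auto simp: kron_def distrib_left index_div_mod_less)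

lemma kron_smult_right:
  fixes A B :: "'a::comm_semiring_0 mat"
  shows "kron A (a \<cdot>\<^sub>m B) = a \<cdot>\<^sub>m kron A B"
  by (intro eq_matI) (auto simp: kron_def index_div_mod_less mult.left_commute)

lemma diag_block_mat_add:
  fixes f g :: "'b \<Rightarrow> 'a::comm_ring_1 mat"
  assumes "\<And>i. i \<in> set is \<Longrightarrow> dim_row (f i) = dim_row (g i) \<and> dim_col (f i) = dim_col (g i)"
  shows "diag_block_mat (map f is) + diag_block_mat (map g is) = diag_block_mat (map (\<lambda>i. f i + g i) is)"
  using assms
proof (induction "is")
  case (Cons i js)
  let ?F = "diag_block_mat (map f js)" and ?G = "diag_block_mat (map g js)"
  have e: "map (dim_row \<circ> f) js = map (dim_row \<circ> g) js" "map (dim_col \<circ> f) js = map (dim_col \<circ> g) js"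
    using Cons.prems by auto
  have d: "dim_row ?F = dim_row ?G" "dim_col ?F = dim_col ?G"
    unfolding dim_diag_block_mat map_map e by (rule refl)+
  have fi: "dim_row (f i) = dim_row (g i)" "dim_col (f i) = dim_col (g i)"
    using Cons.prems by auto
  have IH: "diag_block_mat (map (\<lambda>i. f i + g i) js) = ?F + ?G"
    using Cons by simp
  show ?case
    by (auto simp: Let_def IH d fi intro!: eq_matI)
qed auto

lemma diag_block_mat_smult:
  fixes f :: "'b \<Rightarrow> 'a::comm_ring_1 mat"
  shows "a \<cdot>\<^sub>m diag_block_mat (map f is) = diag_block_mat (map (\<lambda>i. a \<cdot>\<^sub>m f i) is)"
proof (induction "is")
  case (Cons i js)
  show ?case
    by (auto simp: Let_def Cons[symmetric] intro!: eq_matI)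
qed auto

lemma block_algebra_carrier: "block_algebra m k n \<subseteq> carrier_mat (block_dim m k n) (block_dim m k n)"
proof
  fix A assume "A \<in> block_algebra m k n"
  then obtain x where A: "A = diag_block_mat (map (\<lambda>i. kron (1\<^sub>m (k i)) (x i)) [0..<m])"
    and x: "\<forall>i<m. x i \<in> carrier_mat (n i) (n i)" unfolding block_algebra_def by blast
  have *: "(\<Sum>i\<leftarrow>[0..<m]. k i * dim_row (x i)) = block_dim m k n"
          "(\<Sum>i\<leftarrow>[0..<m]. k i * dim_col (x i)) = block_dim m k n"
    using x by (auto simp: block_dim_def interv_sum_list_conv_sum_set_nat atLeast0LessThan intro!: sum.cong)
  show "A \<in> carrier_mat (block_dim m k n) (block_dim m k n)"
    unfolding A by (intro carrier_matI) (simp_all add: dim_diag_block_mat o_def *)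
qed

lemma block_algebra_add:
  assumes "A \<in> block_algebra m k n" "B \<in> block_algebra m k n"
  shows "A + B \<in> block_algebra m k n"
proof -
  obtain x where A: "A = diag_block_mat (map (\<lambda>i. kron (1\<^sub>m (k i)) (x i)) [0..<m])"
    and x: "\<forall>i<m. x i \<in> carrier_mat (n i) (n i)" using assms unfolding block_algebra_def by blast
  obtain y where B: "B = diag_block_mat (map (\<lambda>i. kron (1\<^sub>m (k i)) (y i)) [0..<m])"
    and y: "\<forall>i<m. y i \<in> carrier_mat (n i) (n i)" using assms unfolding block_algebra_def by blast
  have "A + B = diag_block_mat (map (\<lambda>i. kron (1\<^sub>m (k i)) (x i) + kron (1\<^sub>m (k i)) (y i)) [0..<m])"
    unfolding A B
  proof (rule diag_block_mat_add)
    fix i assume "i \<in> set [0..<m]"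
    then have "x i \<in> carrier_mat (n i) (n i)" "y i \<in> carrier_mat (n i) (n i)" using x y by auto
    then show "dim_row (kron (1\<^sub>m (k i)) (x i)) = dim_row (kron (1\<^sub>m (k i)) (y i)) \<and>
        dim_col (kron (1\<^sub>m (k i)) (x i)) = dim_col (kron (1\<^sub>m (k i)) (y i))" by auto
  qed
  also have "map (\<lambda>i. kron (1\<^sub>m (k i)) (x i) + kron (1\<^sub>m (k i)) (y i)) [0..<m]
      = map (\<lambda>i. kron (1\<^sub>m (k i)) (x i + y i)) [0..<m]"
    using x y by (auto simp: kron_add_right)
  finally show ?thesis using x y unfolding block_algebra_def
    by (auto intro!: exI[of _ "\<lambda>i. x i + y i"])
qed

lemma block_algebra_smult:
  assumes "A \<in> block_algebra m k n"
  shows "a \<cdot>\<^sub>m A \<in> block_algebra m k n"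
proof -
  obtain x where A: "A = diag_block_mat (map (\<lambda>i. kron (1\<^sub>m (k i)) (x i)) [0..<m])"
    and x: "\<forall>i<m. x i \<in> carrier_mat (n i) (n i)" using assms unfolding block_algebra_def by blast
  have "a \<cdot>\<^sub>m A = diag_block_mat (map (\<lambda>i. kron (1\<^sub>m (k i)) (a \<cdot>\<^sub>m x i)) [0..<m])"
    unfolding A diag_block_mat_smult kron_smult_right ..
  then show ?thesis using x unfolding block_algebra_def
    by (auto intro!: exI[of _ "\<lambda>i. a \<cdot>\<^sub>m x i"])
qed

lemma block_algebra_zero:
  "0\<^sub>m (block_dim m k n) (block_dim m k n) \<in> block_algebra m k n"
proof -
  let ?A = "diag_block_mat (map (\<lambda>i. kron (1\<^sub>m (k i)) (0\<^sub>m (n i) (n i))) [0..<m]) :: complex mat"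
  have A: "?A \<in> block_algebra m k n" unfolding block_algebra_def by auto
  have "0 \<cdot>\<^sub>m ?A = 0\<^sub>m (block_dim m k n) (block_dim m k n)"
    using subsetD[OF block_algebra_carrier A] by auto
  then show ?thesis using block_algebra_smult[OF A, of 0] by simp
qed

lemma vectorspace_block_space: "vectorspace class_ring (block_space m k n)"
proof -
  let ?V = "module_mat TYPE(complex) (block_dim m k n) (block_dim m k n)"
  interpret V: vectorspace "class_ring :: complex ring" ?V by (rule matrix_vs)
  have "VectorSpace.subspace class_ring (block_algebra m k n) ?V"
    unfolding VectorSpace.subspace_def submodule_def
    using block_algebra_carrier block_algebra_add block_algebra_smult block_algebra_zero
    by (auto simp: module_mat_simps V.vectorspace_axioms V.module_axioms)
  from V.subspace_is_vs[OF this] show ?thesis by (simp add: block_space_def)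
qed

end

theory Submission
  imports Defs
begin

text \<open>
  Write \<open>d = \<Sum> k i * n i\<close>. Blockwise, the inner product of \<open>x\<close> and \<open>y\<close> is
  \<open>(\<Sum> i. k i * tr (x i * (y i)\<^sup>*)) / d\<close>, so the matrix unit \<open>E i a b\<close> of block \<open>i\<close> has squared
  norm \<open>k i / d\<close>, and its inner product with \<open>U\<close> is \<open>k i / d\<close> times the conjugate of the entry
  \<open>(a, b)\<close> of block \<open>i\<close> of \<open>U\<close>.

  \<^emph>\<open>Necessity.\<close> Parseval's identity for the unitary orthonormal basis, applied to \<open>E i 0 b\<close> and
  summed over the \<open>n i\<close> columns \<open>b\<close>, gives \<open>n i * k i / d\<close> on one side. On the other side every
  basis element \<open>U\<close> contributes \<open>(k i / d)\<^sup>2\<close>, since row \<open>0\<close> of its block \<open>i\<close> is a unit vector. If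
  \<open>K\<close> basis elements are involved then \<open>n i = (K / d) * k i\<close>, with a factor independent of \<open>i\<close>
  (\<open>proportional_if_unitary_basis\<close>).

  \<^emph>\<open>Sufficiency.\<close> Let \<open>N = \<Sum> (n i)\<^sup>2\<close>, the dimension of the algebra, and number the
  entries of all blocks consecutively, row by row, so that entry \<open>(a, b)\<close> of block \<open>i\<close> gets the number
  \<open>s = o i + n i * a + b\<close> with \<open>o i = \<Sum> l<i. (n l)\<^sup>2\<close>. Write \<open>w r\<close> for the primitive \<open>r\<close>-th
  root of unity. For \<open>j < N\<close> let \<open>U j\<close> have the entries
    \<open>w (n i) ^ (a * b) * w N ^ (j * s) / sqrt (n i)\<close>.
  Since \<open>s\<close> is a function of \<open>a\<close> plus a function of \<open>b\<close>, block \<open>i\<close> of \<open>U j\<close> is a normalised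
  Fourier matrix multiplied on both sides by unitary diagonal matrices, hence unitary. In the inner
  product of \<open>U j\<close> and \<open>U l\<close> the factors \<open>w (n i) ^ (a * b)\<close> cancel and \<open>k i / n i = 1 / c\<close> comes
  out, which leaves a multiple of \<open>\<Sum> s<N. w N ^ (j * s) * cnj (w N ^ (l * s))\<close>; this vanishes
  for \<open>j \<noteq> l\<close> (\<open>fourier_unitary_orthogonal\<close>). That the \<open>U j\<close> span the algebra is Fourier inversion
  on \<open>N\<close> points (\<open>fourier_unitary_complete\<close>).
\<close>

section \<open>Kronecker products, adjoints and block-diagonal matrices\<close>

lemma sum_div_mod:
  fixes f :: "nat \<Rightarrow> nat \<Rightarrow> 'a::comm_monoid_add"
  shows "(\<Sum>q<a * b. f (q div b) (q mod b)) = (\<Sum>i<a. \<Sum>j<b. f i j)"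
proof -
  have less: "i * b + j < a * b" if "i < a" "j < b" for i j
  proof -
    have "i * b + j < Suc i * b" using that by simp
    also have "\<dots> \<le> a * b" using that by (intro mult_right_mono) auto
    finally show ?thesis .
  qed
  have "(\<Sum>q<a * b. f (q div b) (q mod b)) = (\<Sum>(i, j)\<in>{..<a} \<times> {..<b}. f i j)"
    by (rule sum.reindex_bij_witness[of _ "\<lambda>(i, j). i * b + j" "\<lambda>q. (q div b, q mod b)"])
       (auto simp: less index_div_mod_less)
  then show ?thesis by (simp add: sum.cartesian_product)
qed

lemma sum_lessThan_add:
  fixes f :: "nat \<Rightarrow> 'a::comm_monoid_add"
  shows "(\<Sum>q<a + b. f q) = (\<Sum>q<a. f q) + (\<Sum>q<b. f (a + q))"
  by (induction b) (simp_all add: ac_simps)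

lemma dim_mat_adjoint [simp]:
  "dim_row (mat_adjoint A) = dim_col A" "dim_col (mat_adjoint A) = dim_row A"
  by (simp_all add: mat_adjoint_def)

lemma mat_adjoint_carrier: "A \<in> carrier_mat r c \<Longrightarrow> mat_adjoint A \<in> carrier_mat c r"
  by (intro carrier_matI) simp_all

lemma index_mat_adjoint:
  "i < dim_col A \<Longrightarrow> j < dim_row A \<Longrightarrow> mat_adjoint A $$ (i, j) = conjugate (A $$ (j, i))"
  unfolding mat_adjoint_def by (subst mat_of_rows_index) simp_all

text \<open>The mixed-product rule. An index below a product splits into quotient and remainder, so the sum
  defining an entry of the product factors into two independent sums.\<close>
lemma kron_mult:
  fixes A B C D :: "'a::comm_semiring_0 mat"
  assumes "dim_col A = dim_row C" "dim_col B = dim_row D"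
  shows "kron A B * kron C D = kron (A * C) (B * D)"
proof (rule eq_matI)
  fix i j assume "i < dim_row (kron (A * C) (B * D))" "j < dim_col (kron (A * C) (B * D))"
  then have ij: "i < dim_row A * dim_row B" "j < dim_col C * dim_col D" by auto
  note ij' = index_div_mod_less[OF ij(1)] index_div_mod_less[OF ij(2)]
  have "(kron A B * kron C D) $$ (i, j)
      = (\<Sum>q<dim_row C * dim_row D. kron A B $$ (i, q) * kron C D $$ (q, j))"
    using ij assms by (simp add: times_mat_def scalar_prod_def atLeast0LessThan kron_def)
  also have "\<dots> = (\<Sum>q<dim_row C * dim_row D.
      (A $$ (i div dim_row B, q div dim_row D) * C $$ (q div dim_row D, j div dim_col D))
      * (B $$ (i mod dim_row B, q mod dim_row D) * D $$ (q mod dim_row D, j mod dim_col D)))"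
    using ij assms by (intro sum.cong) (auto simp: kron_def mult_ac)
  also have "\<dots> = (\<Sum>p<dim_row C. \<Sum>q<dim_row D.
      (A $$ (i div dim_row B, p) * C $$ (p, j div dim_col D))
      * (B $$ (i mod dim_row B, q) * D $$ (q, j mod dim_col D)))"
    by (rule sum_div_mod)
  also have "\<dots> = (\<Sum>p<dim_row C. A $$ (i div dim_row B, p) * C $$ (p, j div dim_col D))
      * (\<Sum>q<dim_row D. B $$ (i mod dim_row B, q) * D $$ (q, j mod dim_col D))"
    by (simp add: sum_product)
  also have "\<dots> = kron (A * C) (B * D) $$ (i, j)"
    using ij ij' assms by (simp add: kron_def times_mat_def scalar_prod_def atLeast0LessThan)
  finally show "(kron A B * kron C D) $$ (i, j) = kron (A * C) (B * D) $$ (i, j)" .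
qed auto

lemma kron_one: "kron (1\<^sub>m r) (1\<^sub>m s) = (1\<^sub>m (r * s) :: 'a::semiring_1 mat)"
proof (rule eq_matI)
  fix i j assume "i < dim_row (1\<^sub>m (r * s) :: 'a mat)" "j < dim_col (1\<^sub>m (r * s) :: 'a mat)"
  then have ij: "i < r * s" "j < r * s" by auto
  have "i = j \<longleftrightarrow> i div s = j div s \<and> i mod s = j mod s"
    by (metis div_mult_mod_eq)
  then show "kron (1\<^sub>m r) (1\<^sub>m s) $$ (i, j) = (1\<^sub>m (r * s) :: 'a mat) $$ (i, j)"
    using ij index_div_mod_less[OF ij(1)] index_div_mod_less[OF ij(2)] by (auto simp: kron_def)
qed auto

lemma mat_adjoint_one: "mat_adjoint (1\<^sub>m r) = (1\<^sub>m r :: complex mat)"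
  by (rule eq_matI) (auto simp: index_mat_adjoint)

lemma mat_adjoint_kron:
  fixes A B :: "complex mat"
  shows "mat_adjoint (kron A B) = kron (mat_adjoint A) (mat_adjoint B)"
proof (rule eq_matI)
  fix i j assume "i < dim_row (kron (mat_adjoint A) (mat_adjoint B))"
    "j < dim_col (kron (mat_adjoint A) (mat_adjoint B))"
  then have ij: "i < dim_col A * dim_col B" "j < dim_row A * dim_row B" by auto
  then show "mat_adjoint (kron A B) $$ (i, j) = kron (mat_adjoint A) (mat_adjoint B) $$ (i, j)"
    using index_div_mod_less[OF ij(1)] index_div_mod_less[OF ij(2)]
    by (simp add: index_mat_adjoint) (simp add: kron_def index_mat_adjoint)
qed auto

lemma mat_trace_kron:
  fixes A B :: "'a::comm_semiring_0 mat"
  assumes "square_mat A" "square_mat B"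
  shows "mat_trace (kron A B) = mat_trace A * mat_trace B"
proof -
  have "mat_trace (kron A B) = (\<Sum>q<dim_row A * dim_row B.
      A $$ (q div dim_row B, q div dim_row B) * B $$ (q mod dim_row B, q mod dim_row B))"
    using assms by (auto simp: mat_trace_def kron_def intro!: sum.cong)
  also have "\<dots> = (\<Sum>p<dim_row A. \<Sum>q<dim_row B. A $$ (p, p) * B $$ (q, q))"
    by (rule sum_div_mod)
  finally show ?thesis by (simp add: mat_trace_def sum_product)
qed

lemma diag_block_mat_carrier:
  assumes "\<And>i. i \<in> set is \<Longrightarrow> f i \<in> carrier_mat (r i) (r i)"
  shows "diag_block_mat (map f is) \<in> carrier_mat (sum_list (map r is)) (sum_list (map r is))"
proof -
  have "map (dim_row \<circ> f) is = map r is" "map (dim_col \<circ> f) is = map r is"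
    using assms by (auto dest: carrier_matD)
  then show ?thesis by (intro carrier_matI) (simp_all only: dim_diag_block_mat map_map)
qed

lemma diag_block_mat_mult:
  fixes f g :: "'b \<Rightarrow> 'a::semiring_0 mat"
  assumes "\<And>i. i \<in> set is \<Longrightarrow> f i \<in> carrier_mat (r i) (r i)"
    and "\<And>i. i \<in> set is \<Longrightarrow> g i \<in> carrier_mat (r i) (r i)"
  shows "diag_block_mat (map f is) * diag_block_mat (map g is)
       = diag_block_mat (map (\<lambda>i. f i * g i) is)"
  using assms
proof (induction "is")
  case (Cons i js)
  let ?s = "sum_list (map r js)"
  have F: "diag_block_mat (map f js) \<in> carrier_mat ?s ?s" "diag_block_mat (map g js) \<in> carrier_mat ?s ?s"
    using Cons.prems by (intro diag_block_mat_carrier; simp)+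
  have fi: "f i \<in> carrier_mat (r i) (r i)" "g i \<in> carrier_mat (r i) (r i)" using Cons.prems by auto
  have IH: "diag_block_mat (map (\<lambda>i. f i * g i) js) = diag_block_mat (map f js) * diag_block_mat (map g js)"
    using Cons by simp
  have prods: "f i * g i \<in> carrier_mat (r i) (r i)"
    "diag_block_mat (map f js) * diag_block_mat (map g js) \<in> carrier_mat ?s ?s"
    using F fi by (auto intro: mult_carrier_mat)
  have split: "diag_block_mat (map h (i # js))
      = four_block_mat (h i) (0\<^sub>m (r i) ?s) (0\<^sub>m ?s (r i)) (diag_block_mat (map h js))"
    if "h i \<in> carrier_mat (r i) (r i)" "diag_block_mat (map h js) \<in> carrier_mat ?s ?s" for h :: "'b \<Rightarrow> 'a mat"
    using that by (simp add: Let_def)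
  show ?case
    unfolding split[OF fi(1) F(1)] split[OF fi(2) F(2)]
      split[where h = "\<lambda>i. f i * g i", unfolded IH, OF prods]
      mult_four_block_mat[OF fi(1) zero_carrier_mat zero_carrier_mat F(1)
        fi(2) zero_carrier_mat zero_carrier_mat F(2)]
    by (rule arg_cong4[where f = four_block_mat]) (use fi F prods in auto)
qed auto

lemma mat_adjoint_diag_block_mat:
  fixes f :: "'b \<Rightarrow> complex mat"
  shows "mat_adjoint (diag_block_mat (map f is)) = diag_block_mat (map (\<lambda>i. mat_adjoint (f i)) is)"
proof (induction "is")
  case Nil
  show ?case by (rule eq_matI) auto
next
  case (Cons i js)
  show ?case
    by (auto simp: Let_def Cons[symmetric] index_mat_adjoint intro!: eq_matI)
qed

lemma mat_trace_diag_block_mat: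
  assumes "\<And>A. A \<in> set As \<Longrightarrow> square_mat A"
  shows "mat_trace (diag_block_mat As) = (\<Sum>A\<leftarrow>As. mat_trace A)"
  using assms
proof (induction As)
  case (Cons A As)
  let ?D = "diag_block_mat As"
  have sq: "square_mat A" "square_mat ?D" using Cons.prems by (auto intro!: diag_block_mat_square simp del: square_mat.simps)
  have "mat_trace (diag_block_mat (A # As))
      = (\<Sum>i<dim_row A + dim_row ?D. four_block_mat A (0\<^sub>m (dim_row A) (dim_col ?D))
          (0\<^sub>m (dim_row ?D) (dim_col A)) ?D $$ (i, i))"
    by (simp add: mat_trace_def Let_def)
  also have "\<dots> = (\<Sum>i<dim_row A. A $$ (i, i)) + (\<Sum>i<dim_row ?D. ?D $$ (i, i))"
    using sq by (simp add: sum_lessThan_add)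
  finally show ?case using Cons by (simp add: mat_trace_def)
qed (simp add: mat_trace_def)

section \<open>The block algebra and its trace inner product\<close>

text \<open>The members of the block algebra as a function of their blocks, so that operations on matrices
  translate into operations on families.\<close>
definition block_sum :: "nat \<Rightarrow> (nat \<Rightarrow> nat) \<Rightarrow> (nat \<Rightarrow> complex mat) \<Rightarrow> complex mat" where
  "block_sum m k x = diag_block_mat (map (\<lambda>i. kron (1\<^sub>m (k i)) (x i)) [0..<m])"

lemma block_algebra_eq:
  "block_algebra m k n = {block_sum m k x | x. \<forall>i<m. x i \<in> carrier_mat (n i) (n i)}"
  by (simp add: block_algebra_def block_sum_def)

lemma block_sum_in_algebra:
  assumes "\<And>i. i < m \<Longrightarrow> x i \<in> carrier_mat (n i) (n i)"
  shows "block_sum m k x \<in> block_algebra m k n"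
  using assms unfolding block_algebra_eq by blast

lemma block_sum_carrier:
  assumes "\<And>i. i < m \<Longrightarrow> x i \<in> carrier_mat (n i) (n i)"
  shows "block_sum m k x \<in> carrier_mat (block_dim m k n) (block_dim m k n)"
  using block_sum_in_algebra[of m x n k, OF assms] block_algebra_carrier by blast

lemma block_sum_cong:
  "(\<And>i. i < m \<Longrightarrow> x i = y i) \<Longrightarrow> block_sum m k x = block_sum m k y"
  unfolding block_sum_def by (intro arg_cong[of _ _ diag_block_mat] map_cong) auto

lemma block_sum_mult:
  assumes "\<And>i. i < m \<Longrightarrow> x i \<in> carrier_mat (n i) (n i)"
    and "\<And>i. i < m \<Longrightarrow> y i \<in> carrier_mat (n i) (n i)"
  shows "block_sum m k x * block_sum m k y = block_sum m k (\<lambda>i. x i * y i)"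
proof -
  have kc: "kron (1\<^sub>m (k i)) z \<in> carrier_mat (k i * n i) (k i * n i)"
    if "z \<in> carrier_mat (n i) (n i)" for i and z :: "complex mat"
    using that by (intro carrier_matI) simp_all
  have "block_sum m k x * block_sum m k y
      = diag_block_mat (map (\<lambda>i. kron (1\<^sub>m (k i)) (x i) * kron (1\<^sub>m (k i)) (y i)) [0..<m])"
    unfolding block_sum_def
    by (rule diag_block_mat_mult[where r = "\<lambda>i. k i * n i"]) (use assms kc in auto)
  also have "\<dots> = block_sum m k (\<lambda>i. x i * y i)"
    unfolding block_sum_def
  proof (intro arg_cong[of _ _ diag_block_mat] map_cong refl)
    fix i assume "i \<in> set [0..<m]"
    then have "dim_col (x i) = n i" "dim_row (y i) = n i" using assms by auto
    then show "kron (1\<^sub>m (k i)) (x i) * kron (1\<^sub>m (k i)) (y i) = kron (1\<^sub>m (k i)) (x i * y i)"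
      by (subst kron_mult) simp_all
  qed
  finally show ?thesis .
qed

lemma mat_adjoint_block_sum:
  "mat_adjoint (block_sum m k x) = block_sum m k (\<lambda>i. mat_adjoint (x i))"
  unfolding block_sum_def mat_adjoint_diag_block_mat mat_adjoint_kron mat_adjoint_one ..

lemma block_sum_one:
  "block_sum m k (\<lambda>i. 1\<^sub>m (n i)) = 1\<^sub>m (block_dim m k n)"
proof -
  have "block_sum m k (\<lambda>i. 1\<^sub>m (n i))
      = diag_block_mat (map (\<lambda>A. 1\<^sub>m (dim_row A)) (map (\<lambda>i. 1\<^sub>m (k i * n i) :: complex mat) [0..<m]))"
    by (simp add: block_sum_def kron_one o_def)
  also have "\<dots> = 1\<^sub>m (sum_list (map dim_row (map (\<lambda>i. 1\<^sub>m (k i * n i) :: complex mat) [0..<m])))"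
    by (rule diag_block_one_mat)
  also have "sum_list (map dim_row (map (\<lambda>i. 1\<^sub>m (k i * n i) :: complex mat) [0..<m])) = block_dim m k n"
    by (simp add: o_def block_dim_def interv_sum_list_conv_sum_set_nat atLeast0LessThan)
  finally show ?thesis .
qed

lemma mat_trace_block_sum:
  assumes "\<And>i. i < m \<Longrightarrow> x i \<in> carrier_mat (n i) (n i)"
  shows "mat_trace (block_sum m k x) = (\<Sum>i<m. of_nat (k i) * mat_trace (x i))"
proof -
  have sq: "square_mat (x i)" if "i < m" for i using assms[OF that] by simp
  have "mat_trace (block_sum m k x) = (\<Sum>i\<leftarrow>[0..<m]. mat_trace (kron (1\<^sub>m (k i)) (x i)))"
    unfolding block_sum_def
    by (subst mat_trace_diag_block_mat) (use sq in \<open>auto simp: o_def\<close>)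
  also have "\<dots> = (\<Sum>i<m. mat_trace (kron (1\<^sub>m (k i)) (x i)))"
    by (simp add: interv_sum_list_conv_sum_set_nat atLeast0LessThan)
  also have "\<dots> = (\<Sum>i<m. of_nat (k i) * mat_trace (x i))"
    by (intro sum.cong refl, subst mat_trace_kron) (use sq in \<open>auto simp: mat_trace_def\<close>)
  finally show ?thesis .
qed

lemma mat_trace_mult_adjoint:
  fixes A B :: "complex mat"
  assumes "A \<in> carrier_mat r s" "B \<in> carrier_mat r s"
  shows "mat_trace (A * mat_adjoint B) = (\<Sum>a<r. \<Sum>b<s. A $$ (a, b) * cnj (B $$ (a, b)))"
  using assms
  by (auto simp: mat_trace_def scalar_prod_def index_mat_adjoint atLeast0LessThan intro!: sum.cong)

lemma ntrace_inner_eq_sum: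
  assumes "A \<in> carrier_mat r r" "B \<in> carrier_mat r r"
  shows "ntrace_inner A B = (\<Sum>a<r. \<Sum>b<r. A $$ (a, b) * cnj (B $$ (a, b))) / of_nat r"
  using assms by (simp add: ntrace_inner_def ntrace_def mat_trace_mult_adjoint)

lemma ntrace_inner_add_left:
  assumes "A \<in> carrier_mat r r" "B \<in> carrier_mat r r" "C \<in> carrier_mat r r"
  shows "ntrace_inner (A + B) C = ntrace_inner A C + ntrace_inner B C"
proof -
  have "A + B \<in> carrier_mat r r" using assms by simp
  then show ?thesis using assms
    by (simp add: ntrace_inner_eq_sum[of _ r] add_divide_distrib sum.distrib distrib_right)
qed

lemma ntrace_inner_smult_left:
  assumes "A \<in> carrier_mat r r" "C \<in> carrier_mat r r"
  shows "ntrace_inner (z \<cdot>\<^sub>m A) C = z * ntrace_inner A C"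
proof -
  have "z \<cdot>\<^sub>m A \<in> carrier_mat r r" using assms by simp
  then show ?thesis using assms
    by (simp add: ntrace_inner_eq_sum[of _ r] sum_distrib_left mult_ac)
qed

lemma ntrace_inner_commute:
  assumes "A \<in> carrier_mat r r" "B \<in> carrier_mat r r"
  shows "ntrace_inner B A = cnj (ntrace_inner A B)"
  using assms by (simp add: ntrace_inner_eq_sum[of _ r] mult.commute)

lemma ntrace_inner_unitary:
  assumes "U \<in> carrier_mat r r" "unitary_mat U" "r > 0"
  shows "ntrace_inner U U = 1"
proof -
  have "U * mat_adjoint U = 1\<^sub>m r"
    using assms by (auto simp: unitary_mat_def inverts_mat_def)
  then show ?thesis using assms by (simp add: ntrace_inner_def ntrace_def mat_trace_def)
qed

text \<open>Multiplication and adjoint act block by block, and repeating block \<open>i\<close> \<open>k i\<close> times multiplies its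
  trace by \<open>k i\<close>. These weights are all that the multiplicities contribute to the geometry.\<close>
lemma ntrace_inner_block_sum:
  assumes x: "\<And>i. i < m \<Longrightarrow> x i \<in> carrier_mat (n i) (n i)"
    and y: "\<And>i. i < m \<Longrightarrow> y i \<in> carrier_mat (n i) (n i)"
  shows "ntrace_inner (block_sum m k x) (block_sum m k y)
    = (\<Sum>i<m. of_nat (k i) * (\<Sum>a<n i. \<Sum>b<n i. x i $$ (a, b) * cnj (y i $$ (a, b))))
      / of_nat (block_dim m k n)"
proof -
  have y': "mat_adjoint (y i) \<in> carrier_mat (n i) (n i)" if "i < m" for i
    using y[OF that] by (rule mat_adjoint_carrier)
  have xy: "x i * mat_adjoint (y i) \<in> carrier_mat (n i) (n i)" if "i < m" for i
    using x[OF that] y'[OF that] by (rule mult_carrier_mat)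
  have "block_sum m k x * mat_adjoint (block_sum m k y) = block_sum m k (\<lambda>i. x i * mat_adjoint (y i))"
    unfolding mat_adjoint_block_sum using x y' by (rule block_sum_mult)
  then show ?thesis
    using block_sum_carrier[of m "\<lambda>i. x i * mat_adjoint (y i)" n k, OF xy]
    by (simp add: ntrace_inner_def ntrace_def mat_trace_block_sum[of m _ n k, OF xy]
        mat_trace_mult_adjoint[OF x y])
qed

text \<open>The matrix unit \<open>e a b\<close> of the \<open>i\<close>-th summand, which has \<open>k i\<close> ones as a matrix of size \<open>d\<close>.\<close>
definition block_unit ::
    "nat \<Rightarrow> (nat \<Rightarrow> nat) \<Rightarrow> (nat \<Rightarrow> nat) \<Rightarrow> nat \<Rightarrow> nat \<Rightarrow> nat \<Rightarrow> complex mat" where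
  "block_unit m k n i a b = block_sum m k
     (\<lambda>l. mat (n l) (n l) (\<lambda>(p, q). if l = i \<and> p = a \<and> q = b then 1 else 0))"

lemma block_unit_in_algebra: "block_unit m k n i a b \<in> block_algebra m k n"
  unfolding block_unit_def by (rule block_sum_in_algebra) simp

text \<open>Matrix units read off the entries of the blocks, up to the positive factor \<open>k i / d\<close>. Taking
  inner products with them replaces locating block entries inside the large matrix.\<close>
lemma ntrace_inner_block_unit:
  assumes x: "\<And>i. i < m \<Longrightarrow> x i \<in> carrier_mat (n i) (n i)"
    and "i < m" "a < n i" "b < n i"
  shows "ntrace_inner (block_sum m k x) (block_unit m k n i a b)
    = of_nat (k i) * x i $$ (a, b) / of_nat (block_dim m k n)"
proof -
  have "(\<Sum>p<n l. \<Sum>q<n l. x l $$ (p, q) *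
          cnj (mat (n l) (n l) (\<lambda>(p, q). if l = i \<and> p = a \<and> q = b then 1 else 0) $$ (p, q)))
      = (if l = i then x i $$ (a, b) else 0)" for l
  proof -
    have "(\<Sum>p<n l. \<Sum>q<n l. x l $$ (p, q) *
          cnj (mat (n l) (n l) (\<lambda>(p, q). if l = i \<and> p = a \<and> q = b then 1 else 0) $$ (p, q)))
        = (\<Sum>p<n l. \<Sum>q<n l. if q = b then if p = a then if l = i then x l $$ (p, q) else 0 else 0 else 0)"
      by (intro sum.cong refl) auto
    also have "\<dots> = (if l = i then x i $$ (a, b) else 0)"
      using assms by (simp add: sum.delta)
    finally show ?thesis .
  qed
  then show ?thesis
    unfolding block_unit_def using assms
    by (subst ntrace_inner_block_sum[of m x n]) (simp_all add: if_distrib[of "times _"] sum.delta cong: if_cong)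
qed

lemma block_dim_pos:
  assumes "m \<ge> 1" "\<And>i. i < m \<Longrightarrow> k i > 0" "\<And>i. i < m \<Longrightarrow> n i > 0"
  shows "block_dim m k n > 0"
  unfolding block_dim_def by (rule sum_pos) (use assms in \<open>auto simp: lessThan_empty_iff\<close>)

text \<open>The blocks of a member of the algebra are determined by its inner products with the matrix
  units, because the factors \<open>k i / d\<close> do not vanish.\<close>
lemma block_sum_coord_eqI:
  assumes x: "\<And>i. i < m \<Longrightarrow> x i \<in> carrier_mat (n i) (n i)"
    and y: "\<And>i. i < m \<Longrightarrow> y i \<in> carrier_mat (n i) (n i)"
    and k: "\<And>i. i < m \<Longrightarrow> k i > 0" and d: "block_dim m k n > 0"
    and eq: "\<And>a b. a < n i \<Longrightarrow> b < n i \<Longrightarrow>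
      ntrace_inner (block_sum m k x) (block_unit m k n i a b)
      = ntrace_inner (block_sum m k y) (block_unit m k n i a b)"
    and i: "i < m"
  shows "x i = y i"
proof (rule eq_matI)
  fix a b assume "a < dim_row (y i)" "b < dim_col (y i)"
  then have ab: "a < n i" "b < n i" using y[OF i] by auto
  from eq[OF ab] show "x i $$ (a, b) = y i $$ (a, b)"
    using k[OF i] d
    by (simp add: ntrace_inner_block_unit[of m x n i a b k, OF x i ab]
        ntrace_inner_block_unit[of m y n i a b k, OF y i ab])
qed (use x[OF i] y[OF i] in auto)

text \<open>An induction over \<open>S\<close> from linearity in the first argument. Membership is part of the conclusion
  because linearity is only available for matrices of the right size.\<close>
lemma ntrace_inner_lincomb:
  assumes "finite S" "S \<subseteq> block_algebra m k n"
    and C: "C \<in> carrier_mat (block_dim m k n) (block_dim m k n)"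
  shows "module.lincomb (block_space m k n) c S \<in> block_algebra m k n
    \<and> ntrace_inner (module.lincomb (block_space m k n) c S) C = (\<Sum>v\<in>S. c v * ntrace_inner v C)"
proof -
  interpret V: vectorspace "class_ring :: complex ring" "block_space m k n"
    by (rule vectorspace_block_space)
  have carr: "carrier (block_space m k n) = block_algebra m k n"
    and ops: "A \<oplus>\<^bsub>block_space m k n\<^esub> B = A + B" "z \<odot>\<^bsub>block_space m k n\<^esub> A = z \<cdot>\<^sub>m A"
      "\<zero>\<^bsub>block_space m k n\<^esub> = 0\<^sub>m (block_dim m k n) (block_dim m k n)" for A B z
    by (simp_all add: block_space_def module_mat_def)
  have in_alg: "c v \<cdot>\<^sub>m v \<in> block_algebra m k n" if "v \<in> block_algebra m k n" for v
    using that by (rule block_algebra_smult)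
  have "V.lincomb c S \<in> block_algebra m k n
    \<and> ntrace_inner (V.lincomb c S) C = (\<Sum>v\<in>S. c v * ntrace_inner v C)"
    using assms(1,2)
  proof (induction S)
    case empty
    have "ntrace_inner (0\<^sub>m (block_dim m k n) (block_dim m k n)) C = 0"
      by (simp add: ntrace_inner_eq_sum[OF zero_carrier_mat C])
    then show ?case by (simp add: V.lincomb_def ops block_algebra_zero)
  next
    case (insert v S)
    have ins: "V.lincomb c (insert v S) = c v \<cdot>\<^sub>m v + V.lincomb c S"
      unfolding V.lincomb_def
      by (subst V.finsum_insert) (use insert in_alg in \<open>auto simp: carr ops\<close>)
    from insert have "v \<in> block_algebra m k n" "V.lincomb c S \<in> block_algebra m k n" by auto
    moreover from this have "v \<in> carrier_mat (block_dim m k n) (block_dim m k n)"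
      "V.lincomb c S \<in> carrier_mat (block_dim m k n) (block_dim m k n)"
      using block_algebra_carrier by blast+
    ultimately show ?case
      using insert C in_alg[of v] unfolding ins
      by (simp add: block_algebra_add ntrace_inner_add_left[of _ "block_dim m k n"] smult_carrier_mat
          ntrace_inner_smult_left[of _ "block_dim m k n"])
  qed
  then show ?thesis .
qed

lemma mat_unit_row_sum:
  fixes X :: "complex mat"
  assumes "X \<in> carrier_mat r s" "X * mat_adjoint X = 1\<^sub>m r" "a < r"
  shows "(\<Sum>b<s. X $$ (a, b) * cnj (X $$ (a, b))) = 1"
proof -
  have "(X * mat_adjoint X) $$ (a, a) = (\<Sum>b<s. X $$ (a, b) * cnj (X $$ (a, b)))"
    using assms(1,3) by (simp add: scalar_prod_def index_mat_adjoint atLeast0LessThan)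
  then show ?thesis using assms by simp
qed

lemma unitary_matI:
  assumes "U \<in> carrier_mat r r" "U * mat_adjoint U = 1\<^sub>m r"
  shows "unitary_mat U"
proof -
  have "mat_adjoint U * U = 1\<^sub>m r"
    using assms mat_mult_left_right_inverse mat_adjoint_carrier by metis
  then show ?thesis using assms by (auto simp: unitary_mat_def inverts_mat_def)
qed

lemma unitary_block_sumI:
  assumes x: "\<And>i. i < m \<Longrightarrow> x i \<in> carrier_mat (n i) (n i)"
    and u: "\<And>i. i < m \<Longrightarrow> x i * mat_adjoint (x i) = 1\<^sub>m (n i)"
  shows "unitary_mat (block_sum m k x)"
proof (rule unitary_matI)
  show "block_sum m k x \<in> carrier_mat (block_dim m k n) (block_dim m k n)"
    using x by (rule block_sum_carrier)
  have "block_sum m k x * mat_adjoint (block_sum m k x) = block_sum m k (\<lambda>i. x i * mat_adjoint (x i))"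
    unfolding mat_adjoint_block_sum by (rule block_sum_mult[where n = n]) (use x in \<open>auto intro: mat_adjoint_carrier\<close>)
  also have "\<dots> = block_sum m k (\<lambda>i. 1\<^sub>m (n i))"
    using u by (rule block_sum_cong)
  finally show "block_sum m k x * mat_adjoint (block_sum m k x) = 1\<^sub>m (block_dim m k n)"
    by (simp add: block_sum_one)
qed

text \<open>The matrices \<open>x i * (x i)\<^sup>*\<close> are the blocks of \<open>U * U\<^sup>* = 1\<close>, and blocks are unique.\<close>
lemma unitary_block_sumD:
  assumes x: "\<And>i. i < m \<Longrightarrow> x i \<in> carrier_mat (n i) (n i)"
    and k: "\<And>i. i < m \<Longrightarrow> k i > 0" and d: "block_dim m k n > 0"
    and u: "unitary_mat (block_sum m k x)" and i: "i < m"
  shows "x i * mat_adjoint (x i) = 1\<^sub>m (n i)"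
proof -
  have y: "x i * mat_adjoint (x i) \<in> carrier_mat (n i) (n i)" if "i < m" for i
    using x[OF that] mat_adjoint_carrier[OF x[OF that]] by (rule mult_carrier_mat)
  have "block_sum m k (\<lambda>i. x i * mat_adjoint (x i)) = block_sum m k x * mat_adjoint (block_sum m k x)"
    unfolding mat_adjoint_block_sum
    by (rule block_sum_mult[where n = n, symmetric]) (use x in \<open>auto intro: mat_adjoint_carrier\<close>)
  also have "\<dots> = 1\<^sub>m (block_dim m k n)"
    using u block_sum_carrier[of m x n k, OF x] by (auto simp: unitary_mat_def inverts_mat_def)
  also have "\<dots> = block_sum m k (\<lambda>i. 1\<^sub>m (n i))" by (simp add: block_sum_one)
  finally have eq: "block_sum m k (\<lambda>i. x i * mat_adjoint (x i)) = block_sum m k (\<lambda>i. 1\<^sub>m (n i))" .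
  show ?thesis
    by (rule block_sum_coord_eqI[where y = "\<lambda>i. 1\<^sub>m (n i)" and n = n, OF y _ k d _ i]) (simp_all add: eq)
qed

section \<open>Parseval's identity and the necessity of proportionality\<close>

lemma ntrace_inner_lincomb_orthonormal:
  assumes B: "B \<subseteq> block_algebra m k n" and u: "\<And>U. U \<in> B \<Longrightarrow> unitary_mat U"
    and orth: "pairwise (\<lambda>U V. ntrace_inner U V = 0) B" and d: "block_dim m k n > 0"
    and A: "finite A" "A \<subseteq> B" and U: "U \<in> B"
  shows "ntrace_inner (module.lincomb (block_space m k n) c A) U = (if U \<in> A then c U else 0)"
proof -
  have Uc: "U \<in> carrier_mat (block_dim m k n) (block_dim m k n)"
    using U B block_algebra_carrier by blast
  have ip: "ntrace_inner v U = (if v = U then 1 else 0)" if "v \<in> A" for v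
  proof (cases "v = U")
    case True
    then show ?thesis using ntrace_inner_unitary[OF Uc u[OF U] d] by simp
  next
    case False
    then show ?thesis using orth that A U by (auto simp: pairwise_def)
  qed
  have "ntrace_inner (module.lincomb (block_space m k n) c A) U = (\<Sum>v\<in>A. c v * ntrace_inner v U)"
    using ntrace_inner_lincomb[OF A(1) _ Uc] A B by blast
  also have "\<dots> = (\<Sum>v\<in>A. if v = U then c U else 0)"
    by (intro sum.cong) (auto simp: ip)
  finally show ?thesis using A by (simp add: sum.delta)
qed

text \<open>For \<open>E = \<Sum> c U * U\<close> over a finite \<open>A\<close>, orthonormality gives \<open>c U = \<langle>E, U\<rangle>\<close>, with coefficient zero
  outside \<open>A\<close>. Finite supersets \<open>A'\<close> are allowed so that several vectors \<open>E\<close> can share one index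
  set, without knowing whether \<open>B\<close> is finite.\<close>
lemma parseval_unitary_basis:
  assumes B: "B \<subseteq> block_algebra m k n" and u: "\<And>U. U \<in> B \<Longrightarrow> unitary_mat U"
    and orth: "pairwise (\<lambda>U V. ntrace_inner U V = 0) B" and d: "block_dim m k n > 0"
    and E: "E \<in> LinearCombinations.module.span class_ring (block_space m k n) B"
  obtains A where "finite A" "A \<subseteq> B"
    "\<And>A'. finite A' \<Longrightarrow> A \<subseteq> A' \<Longrightarrow> A' \<subseteq> B \<Longrightarrow>
       (\<Sum>U\<in>A'. ntrace_inner E U * cnj (ntrace_inner E U)) = ntrace_inner E E"
proof -
  interpret V: vectorspace "class_ring :: complex ring" "block_space m k n"
    by (rule vectorspace_block_space)
  from E obtain c A where A: "finite A" "A \<subseteq> B" and Ec: "E = V.lincomb c A"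
    unfolding V.span_def by blast
  note coeff = ntrace_inner_lincomb_orthonormal[OF B u orth d A, of _ c, folded Ec]
  have sub: "A \<subseteq> block_algebra m k n" using A B by blast
  have Ecarr: "E \<in> carrier_mat (block_dim m k n) (block_dim m k n)"
    using ntrace_inner_lincomb[OF A(1) sub one_carrier_mat, of c] block_algebra_carrier Ec by blast
  have "(\<Sum>U\<in>A'. ntrace_inner E U * cnj (ntrace_inner E U)) = ntrace_inner E E"
    if A': "finite A'" "A \<subseteq> A'" "A' \<subseteq> B" for A'
  proof -
    have "ntrace_inner E E = (\<Sum>v\<in>A. c v * ntrace_inner v E)"
      using ntrace_inner_lincomb[OF A(1) sub Ecarr, of c] Ec by simp
    also have "\<dots> = (\<Sum>U\<in>A. ntrace_inner E U * cnj (ntrace_inner E U))"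
    proof (intro sum.cong refl)
      fix U assume "U \<in> A"
      then have "U \<in> B" "U \<in> carrier_mat (block_dim m k n) (block_dim m k n)"
        using A sub block_algebra_carrier by blast+
      then show "c U * ntrace_inner U E = ntrace_inner E U * cnj (ntrace_inner E U)"
        using coeff \<open>U \<in> A\<close> by (simp add: ntrace_inner_commute[OF Ecarr])
    qed
    also have "\<dots> = (\<Sum>U\<in>A'. ntrace_inner E U * cnj (ntrace_inner E U))"
      using A' coeff by (intro sum.mono_neutral_left) auto
    finally show ?thesis by simp
  qed
  with A show thesis by (rule that)
qed

text \<open>The inner products are \<open>k i / d\<close> times the conjugated entries of row \<open>a\<close> of block \<open>i\<close> of \<open>U\<close>, and
  that row is a unit vector because the block is unitary. Necessity draws on
  unitarity in full at this point, beyond the normalisation of the basis elements.\<close>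
lemma block_unit_row_parseval:
  assumes k: "\<And>i. i < m \<Longrightarrow> k i > 0" and d: "block_dim m k n > 0"
    and U: "U \<in> block_algebra m k n" "unitary_mat U" and i: "i < m" "a < n i"
  shows "(\<Sum>b<n i. ntrace_inner (block_unit m k n i a b) U * cnj (ntrace_inner (block_unit m k n i a b) U))
    = (of_nat (k i) / of_nat (block_dim m k n))\<^sup>2"
proof -
  from U(1) obtain x where Ux: "U = block_sum m k x"
    and x: "\<And>i. i < m \<Longrightarrow> x i \<in> carrier_mat (n i) (n i)"
    unfolding block_algebra_eq by blast
  have "x i * mat_adjoint (x i) = 1\<^sub>m (n i)"
    using unitary_block_sumD[of m x n k, OF x k d _ i(1)] U(2) Ux by blast
  then have row: "(\<Sum>b<n i. x i $$ (a, b) * cnj (x i $$ (a, b))) = 1"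
    using mat_unit_row_sum[OF x[OF i(1)] _ i(2)] by blast
  have "ntrace_inner (block_unit m k n i a b) U
      = of_nat (k i) * cnj (x i $$ (a, b)) / of_nat (block_dim m k n)" if "b < n i" for b
  proof -
    have "ntrace_inner (block_unit m k n i a b) U = cnj (ntrace_inner U (block_unit m k n i a b))"
      using U(1) block_unit_in_algebra[of m k n i a b] block_algebra_carrier
      by (intro ntrace_inner_commute) blast+
    then show ?thesis using ntrace_inner_block_unit[of m x n i a b k, OF x i that] Ux by simp
  qed
  then have "(\<Sum>b<n i. ntrace_inner (block_unit m k n i a b) U * cnj (ntrace_inner (block_unit m k n i a b) U))
      = (\<Sum>b<n i. (of_nat (k i) / of_nat (block_dim m k n))\<^sup>2 * (x i $$ (a, b) * cnj (x i $$ (a, b))))"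
    by (intro sum.cong refl) (simp add: power2_eq_square)
  then show ?thesis by (simp add: sum_distrib_left[symmetric] row)
qed

lemma ntrace_inner_block_unit_self:
  assumes "i < m" "a < n i" "b < n i"
  shows "ntrace_inner (block_unit m k n i a b) (block_unit m k n i a b)
    = of_nat (k i) / of_nat (block_dim m k n)"
  by (subst block_unit_def, subst ntrace_inner_block_unit) (use assms in auto)

text \<open>Sum Parseval's identity over the matrix units in row \<open>0\<close> of block \<open>i\<close>: the norms give
  \<open>n i * k i / d\<close>, the basis elements give \<open>card S * (k i / d)\<^sup>2\<close>. Row \<open>0\<close> exists because
  \<open>n i > 0\<close>, and cancelling \<open>k i / d\<close> uses \<open>k i > 0\<close>.\<close>
lemma proportional_if_unitary_basis:
  assumes m: "m \<ge> 1" and k: "\<And>i. i < m \<Longrightarrow> k i > 0" and n: "\<And>i. i < m \<Longrightarrow> n i > 0"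
    and basis: "vectorspace.basis class_ring (block_space m k n) B"
    and u: "\<And>U. U \<in> B \<Longrightarrow> unitary_mat U"
    and orth: "pairwise (\<lambda>U V. ntrace_inner U V = 0) B"
  shows "\<exists>c::real. \<forall>i<m. real (n i) = c * real (k i)"
proof -
  interpret V: vectorspace "class_ring :: complex ring" "block_space m k n"
    by (rule vectorspace_block_space)
  let ?d = "block_dim m k n"
  have d: "?d > 0" using m k n by (rule block_dim_pos)
  have "carrier (block_space m k n) = block_algebra m k n" by (simp add: block_space_def)
  then have B: "B \<subseteq> block_algebra m k n" and span: "V.span B = block_algebra m k n"
    using basis by (auto simp: V.basis_def)
  have "\<exists>A. finite A \<and> A \<subseteq> B \<and> (\<forall>A'. finite A' \<longrightarrow> A \<subseteq> A' \<longrightarrow> A' \<subseteq> B \<longrightarrow>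
       (\<Sum>U\<in>A'. ntrace_inner (block_unit m k n i 0 b) U * cnj (ntrace_inner (block_unit m k n i 0 b) U))
        = ntrace_inner (block_unit m k n i 0 b) (block_unit m k n i 0 b))" for i b
    using parseval_unitary_basis[OF B u orth d, of "block_unit m k n i 0 b"]
      block_unit_in_algebra[of m k n i 0 b] span by metis
  then obtain A where A: "\<And>i b. finite (A i b)" "\<And>i b. A i b \<subseteq> B"
    and pars: "\<And>i b A'. finite A' \<Longrightarrow> A i b \<subseteq> A' \<Longrightarrow> A' \<subseteq> B \<Longrightarrow>
       (\<Sum>U\<in>A'. ntrace_inner (block_unit m k n i 0 b) U * cnj (ntrace_inner (block_unit m k n i 0 b) U))
        = ntrace_inner (block_unit m k n i 0 b) (block_unit m k n i 0 b)"
    by metis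
  \<comment> \<open>One finite set that supports the expansions of all matrix units in use, so that its
    cardinality is the same for every block.\<close>
  define S where "S = (\<Union>i<m. \<Union>b<n i. A i b)"
  have S: "finite S" "S \<subseteq> B" unfolding S_def using A by blast+
  have "real (n i) = (real (card S) / real ?d) * real (k i)" if i: "i < m" for i
  proof -
    let ?r = "of_nat (k i) / of_nat ?d :: complex"
    let ?h = "\<lambda>b U. ntrace_inner (block_unit m k n i 0 b) U * cnj (ntrace_inner (block_unit m k n i 0 b) U)"
    have "of_nat (n i) * ?r = (\<Sum>b<n i. ntrace_inner (block_unit m k n i 0 b) (block_unit m k n i 0 b))"
      using i n[OF i] by (simp add: ntrace_inner_block_unit_self)
    also have "\<dots> = (\<Sum>b<n i. \<Sum>U\<in>S. ?h b U)"
      using i by (intro sum.cong refl pars[symmetric] S) (auto simp: S_def)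
    also have "\<dots> = (\<Sum>U\<in>S. \<Sum>b<n i. ?h b U)" by (rule sum.swap)
    also have "\<dots> = (\<Sum>U\<in>S. ?r\<^sup>2)"
      using S B u i n[OF i] by (intro sum.cong refl block_unit_row_parseval k d) auto
    also have "\<dots> = of_nat (card S) * ?r\<^sup>2" by simp
    finally have "of_nat (n i) * ?r = (of_nat (card S) * ?r) * ?r"
      by (simp add: power2_eq_square mult.assoc)
    moreover have "?r \<noteq> 0" using k[OF i] d by simp
    ultimately have "of_nat (n i) = (of_nat (card S) * ?r :: complex)"
      by (metis mult_right_cancel)
    then have "complex_of_real (real (n i)) = complex_of_real ((real (card S) / real ?d) * real (k i))"
      by simp
    then show ?thesis by (simp only: of_real_eq_iff)
  qed
  then show ?thesis by blast
qed

section \<open>Roots of unity and the numbering of matrix entries\<close>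

definition root_unity :: "nat \<Rightarrow> complex" where
  "root_unity N = cis (2 * pi / real N)"

lemma root_unity_mult_cnj: "root_unity N ^ s * cnj (root_unity N ^ s) = 1"
  by (simp add: root_unity_def DeMoivre cis_cnj cis_mult)

lemma root_unity_power_cancel: "root_unity N ^ N = 1"
  by (cases "N = 0") (simp_all add: root_unity_def DeMoivre)

text \<open>The terms form a geometric progression with ratio \<open>z = \<omega>\<^sup>j * cnj (\<omega>\<^sup>l)\<close>, an \<open>N\<close>-th root of unity
  that equals \<open>1\<close> only for \<open>j = l\<close>, since distinct exponents below \<open>N\<close> give distinct powers of \<open>\<omega>\<close>.\<close>
lemma root_unity_orthogonal:
  assumes "j < N" "l < N"
  shows "(\<Sum>s<N. root_unity N ^ (j * s) * cnj (root_unity N ^ (l * s))) = (if j = l then of_nat N else 0)"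
proof -
  define z where "z = root_unity N ^ j * cnj (root_unity N ^ l)"
  have zs: "root_unity N ^ (j * s) * cnj (root_unity N ^ (l * s)) = z ^ s" for s
    by (simp add: z_def power_mult power_mult_distrib)
  have sum: "(\<Sum>s<N. root_unity N ^ (j * s) * cnj (root_unity N ^ (l * s))) = (\<Sum>s<N. z ^ s)"
    by (simp only: zs)
  show ?thesis
    unfolding sum
  proof (cases "j = l")
    case True
    then have "z = 1" using root_unity_mult_cnj by (simp add: z_def)
    with True show "(\<Sum>s<N. z ^ s) = (if j = l then of_nat N else 0)" by simp
  next
    case False
    have "inj_on (\<lambda>k. cis (2 * pi * real k / real N)) {..<N}"
      using bij_betw_roots_unity[of N] assms by (auto simp: bij_betw_def)
    then have ne: "root_unity N ^ j \<noteq> root_unity N ^ l"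
      using assms False by (auto simp: root_unity_def DeMoivre inj_on_def mult_ac)
    have "z * root_unity N ^ l = root_unity N ^ j"
      using root_unity_mult_cnj[of N l] by (simp add: z_def mult.assoc mult.commute[of "cnj (root_unity N) ^ l"])
    with ne have "z \<noteq> 1" by auto
    moreover have "z ^ N = 1"
    proof -
      have "z ^ N = (root_unity N ^ N) ^ j * cnj ((root_unity N ^ N) ^ l)"
        by (simp add: z_def power_mult_distrib mult.commute flip: power_mult)
      then show ?thesis by (simp only: root_unity_power_cancel) simp
    qed
    ultimately have "(\<Sum>s<N. z ^ s) = 0" by (subst geometric_sum) auto
    then show "(\<Sum>s<N. z ^ s) = (if j = l then of_nat N else 0)" using False by simp
  qed
qed

definition square_offset :: "(nat \<Rightarrow> nat) \<Rightarrow> nat \<Rightarrow> nat" where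
  "square_offset n i = (\<Sum>l<i. n l * n l)"

text \<open>Numbers the entries of all blocks consecutively: block after block, row by row.\<close>
abbreviation block_index :: "(nat \<Rightarrow> nat) \<Rightarrow> nat \<Rightarrow> nat \<Rightarrow> nat \<Rightarrow> nat" where
  "block_index n i a b \<equiv> square_offset n i + n i * a + b"

lemma square_offset_mono: "i \<le> j \<Longrightarrow> square_offset n i \<le> square_offset n j"
  unfolding square_offset_def by (intro sum_mono2) auto

lemma block_index_less:
  assumes "a < n i" "b < n i"
  shows "block_index n i a b < square_offset n (Suc i)"
proof -
  have "n i * a + b < n i * Suc a" using assms by simp
  also have "\<dots> \<le> n i * n i" using assms by (intro mult_left_mono) auto
  finally show ?thesis by (simp add: square_offset_def)
qed

text \<open>The offsets determine the block, then division by \<open>n i\<close> determines row and column. Surjectivity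
  follows by counting.\<close>
lemma bij_betw_block_index:
  "bij_betw (\<lambda>(i, a, b). block_index n i a b)
     (SIGMA i:{..<m}. {..<n i} \<times> {..<n i}) {..<square_offset n m}"
proof -
  let ?I = "SIGMA i:{..<m}. {..<n i} \<times> {..<n i}" and ?f = "\<lambda>(i, a, b). block_index n i a b"
  have same: "i = i' \<and> a = a' \<and> b = b'"
    if eq: "block_index n i a b = block_index n i' a' b'"
      and r: "a < n i" "b < n i" "a' < n i'" "b' < n i'" for i a b i' a' b'
  proof -
    have "\<not> i < i'" "\<not> i' < i"
      using block_index_less[of a n i b] block_index_less[of a' n i' b'] r eq
        square_offset_mono[of "Suc i" i' n] square_offset_mono[of "Suc i'" i n] by force+
    then have i: "i = i'" by simp
    then have e: "n i * a + b = n i * a' + b'" using eq by simp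
    have "a = (n i * a + b) div n i" "b = (n i * a + b) mod n i" using r by simp_all
    moreover have "a' = (n i * a' + b') div n i" "b' = (n i * a' + b') mod n i" using r i by simp_all
    ultimately show ?thesis unfolding e using i by metis
  qed
  have inj: "inj_on ?f ?I"
  proof (rule inj_onI)
    fix p q assume "p \<in> ?I" "q \<in> ?I" "?f p = ?f q"
    obtain i a b i' a' b' where p: "p = (i, a, b)" and q: "q = (i', a', b')"
      by (cases p, cases q) blast
    then show "p = q"
      using same[of i a b i' a' b'] \<open>p \<in> ?I\<close> \<open>q \<in> ?I\<close> \<open>?f p = ?f q\<close> by simp
  qed
  have "?f p < square_offset n m" if "p \<in> ?I" for p
  proof -
    obtain i a b where p: "p = (i, a, b)" by (cases p)
    with that have r: "i < m" "a < n i" "b < n i" by auto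
    from block_index_less[of a n i b, OF r(2,3)] square_offset_mono[of "Suc i" m n] r(1) p show ?thesis by simp
  qed
  then have sub: "?f ` ?I \<subseteq> {..<square_offset n m}" by blast
  have "card (?f ` ?I) = card {..<square_offset n m}"
    unfolding card_image[OF inj] by (simp add: square_offset_def)
  with sub have "?f ` ?I = {..<square_offset n m}" by (intro card_subset_eq) auto
  with inj show ?thesis by (simp add: bij_betw_def)
qed

lemma sum_block_index:
  fixes f :: "nat \<Rightarrow> 'a::comm_monoid_add"
  shows "(\<Sum>i<m. \<Sum>a<n i. \<Sum>b<n i. f (block_index n i a b)) = (\<Sum>s<square_offset n m. f s)"
proof -
  have "(\<Sum>i<m. \<Sum>a<n i. \<Sum>b<n i. f (block_index n i a b))
      = (\<Sum>(i, a, b)\<in>(SIGMA i:{..<m}. {..<n i} \<times> {..<n i}). f (block_index n i a b))"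
    by (simp add: sum.cartesian_product sum.Sigma)
  also have "\<dots> = (\<Sum>s<square_offset n m. f s)"
    using sum.reindex_bij_betw[OF bij_betw_block_index[of n m], of f] by (simp add: case_prod_unfold)
  finally show ?thesis .
qed

section \<open>The basis of twisted Fourier matrices\<close>

text \<open>For \<open>\<zeta> = root_unity N ^ j\<close> this is \<open>D * F * D'\<close> with \<open>F\<close> the unitary Fourier matrix of size \<open>r\<close> and
  diagonal unitaries \<open>D = diag (\<zeta> ^ (t + r * a))\<close> and \<open>D' = diag (\<zeta> ^ b)\<close>.\<close>
definition twisted_fourier :: "nat \<Rightarrow> nat \<Rightarrow> nat \<Rightarrow> nat \<Rightarrow> complex mat" where
  "twisted_fourier r N t j = mat r r (\<lambda>(a, b).
     root_unity r ^ (a * b) * root_unity N ^ (j * (t + r * a + b)) / of_real (sqrt (real r)))"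

lemma twisted_fourier_carrier [simp]: "twisted_fourier r N t j \<in> carrier_mat r r"
  by (simp add: twisted_fourier_def)

text \<open>The twist is a function of the row times a function of the column. In the product of two rows the
  column factors cancel and the row factors come out of the sum, leaving orthogonality of the rows
  of the Fourier matrix.\<close>
lemma twisted_fourier_unitary:
  "twisted_fourier r N t j * mat_adjoint (twisted_fourier r N t j) = 1\<^sub>m r"
proof (rule eq_matI)
  fix a a' assume "a < dim_row (1\<^sub>m r :: complex mat)" "a' < dim_col (1\<^sub>m r :: complex mat)"
  then have aa: "a < r" "a' < r" by auto
  let ?p = "\<lambda>a. root_unity N ^ (j * (t + r * a))"
  let ?q = "\<lambda>b. root_unity N ^ (j * b)"
  have split: "root_unity N ^ (j * (t + r * a + b)) = ?p a * ?q b" for a b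
    by (simp add: power_add[symmetric] distrib_left)
  have sq: "complex_of_real (sqrt (real r)) * complex_of_real (sqrt (real r)) = of_nat r"
    by (simp flip: of_real_mult)
  have alg: "(w * (p * q) / s) * cnj (w' * (p' * q) / s) = p * cnj p' / (s * cnj s) * ((q * cnj q) * (w * cnj w'))"
    for w w' p p' q s :: complex by (simp add: mult_ac)
  have entry: "twisted_fourier r N t j $$ (a, b) = root_unity r ^ (a * b) * (?p a * ?q b) / of_real (sqrt (real r))"
    if "a < r" "b < r" for a b
    using that by (simp add: twisted_fourier_def split)
  have "(twisted_fourier r N t j * mat_adjoint (twisted_fourier r N t j)) $$ (a, a')
      = (\<Sum>b<r. twisted_fourier r N t j $$ (a, b) * cnj (twisted_fourier r N t j $$ (a', b)))"
    using aa carrier_matD[OF twisted_fourier_carrier[of r N t j]]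
    by (simp add: scalar_prod_def index_mat_adjoint atLeast0LessThan)
  also have "\<dots> = (\<Sum>b<r. ?p a * cnj (?p a') / of_nat r * ((?q b * cnj (?q b)) *
      (root_unity r ^ (a * b) * cnj (root_unity r ^ (a' * b)))))"
    using aa by (intro sum.cong refl) (simp only: entry lessThan_iff alg complex_cnj_complex_of_real sq)
  also have "\<dots> = ?p a * cnj (?p a') / of_nat r * (if a = a' then of_nat r else 0)"
    by (simp only: root_unity_mult_cnj mult_1_left sum_distrib_left[symmetric] root_unity_orthogonal[OF aa])
  also have "\<dots> = 1\<^sub>m r $$ (a, a')"
    using aa root_unity_mult_cnj[of N "j * (t + r * a)"] by auto
  finally show "(twisted_fourier r N t j * mat_adjoint (twisted_fourier r N t j)) $$ (a, a') = 1\<^sub>m r $$ (a, a')" .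
qed (use carrier_matD[OF twisted_fourier_carrier[of r N t j]] in auto)

text \<open>Orthonormality gives injectivity of the family and linear independence. Completeness is required
  only for inner products with matrix units, which determine a member of the algebra.\<close>
lemma unitary_basis_of_orthogonal_family:
  fixes U :: "nat \<Rightarrow> complex mat"
  assumes d: "block_dim m k n > 0"
    and alg: "\<And>j. j < N \<Longrightarrow> U j \<in> block_algebra m k n"
    and unitary: "\<And>j. j < N \<Longrightarrow> unitary_mat (U j)"
    and orth: "\<And>j l. j < N \<Longrightarrow> l < N \<Longrightarrow> j \<noteq> l \<Longrightarrow> ntrace_inner (U j) (U l) = 0"
    and complete: "\<And>A. A \<in> block_algebra m k n \<Longrightarrow> \<exists>g. \<forall>i a b. i < m \<longrightarrow> a < n i \<longrightarrow> b < n i \<longrightarrow>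
      ntrace_inner A (block_unit m k n i a b) = (\<Sum>j<N. g j * ntrace_inner (U j) (block_unit m k n i a b))"
    and k: "\<And>i. i < m \<Longrightarrow> k i > 0"
  shows "vectorspace.basis class_ring (block_space m k n) (U ` {..<N})"
    and "pairwise (\<lambda>U V. ntrace_inner U V = 0) (U ` {..<N})"
proof -
  interpret V: vectorspace "class_ring :: complex ring" "block_space m k n"
    by (rule vectorspace_block_space)
  let ?B = "U ` {..<N}"
  have carr: "carrier (block_space m k n) = block_algebra m k n"
    and zero: "\<zero>\<^bsub>block_space m k n\<^esub> = 0\<^sub>m (block_dim m k n) (block_dim m k n)"
    by (simp_all add: block_space_def module_mat_def)
  have Ucarr: "U j \<in> carrier_mat (block_dim m k n) (block_dim m k n)" if "j < N" for j
    using alg[OF that] block_algebra_carrier by blast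
  have B: "?B \<subseteq> block_algebra m k n" "\<And>V. V \<in> ?B \<Longrightarrow> unitary_mat V" using alg unitary by auto
  have inj: "inj_on U {..<N}"
  proof (rule inj_onI, rule ccontr)
    fix j l assume jl: "j \<in> {..<N}" "l \<in> {..<N}" "U j = U l" "j \<noteq> l"
    then have "ntrace_inner (U j) (U j) = 0" using orth[of j l] by simp
    moreover have "ntrace_inner (U j) (U j) = 1"
      using jl by (intro ntrace_inner_unitary[OF Ucarr unitary d]) auto
    ultimately show False by simp
  qed
  show pw: "pairwise (\<lambda>U V. ntrace_inner U V = 0) ?B"
    unfolding pairwise_def using orth by blast
  have "V.lin_indpt ?B"
  proof
    assume "V.lin_dep ?B"
    then obtain A c v where A: "finite A" "A \<subseteq> ?B" and 0: "V.lincomb c A = \<zero>\<^bsub>block_space m k n\<^esub>"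
      and v: "v \<in> A" "c v \<noteq> \<zero>\<^bsub>class_ring\<^esub>"
      unfolding V.lin_dep_def by blast
    have "v \<in> carrier_mat (block_dim m k n) (block_dim m k n)"
      using A v B(1) block_algebra_carrier by blast
    then have "ntrace_inner (V.lincomb c A) v = 0"
      unfolding 0 zero by (simp add: ntrace_inner_eq_sum[OF zero_carrier_mat])
    then have "c v = 0"
      using ntrace_inner_lincomb_orthonormal[OF B pw d A, of v c] v A by auto
    with v show False by (simp add: class_ring_simps)
  qed
  moreover have "V.span ?B = block_algebra m k n"
  proof
    show "V.span ?B \<subseteq> block_algebra m k n"
      using V.span_is_subset2[of ?B] B(1) carr by simp
    show "block_algebra m k n \<subseteq> V.span ?B"
    proof
      fix A assume A: "A \<in> block_algebra m k n"
      from complete[OF A] obtain g where g: "\<And>i a b. i < m \<Longrightarrow> a < n i \<Longrightarrow> b < n i \<Longrightarrow>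
          ntrace_inner A (block_unit m k n i a b) = (\<Sum>j<N. g j * ntrace_inner (U j) (block_unit m k n i a b))"
        by blast
      define c where "c = g \<circ> the_inv_into {..<N} U"
      let ?L = "V.lincomb c ?B"
      have L: "?L \<in> block_algebra m k n"
        using ntrace_inner_lincomb[OF _ B(1) one_carrier_mat] by blast
      have coord: "ntrace_inner ?L (block_unit m k n i a b) = ntrace_inner A (block_unit m k n i a b)"
        if "i < m" "a < n i" "b < n i" for i a b
      proof -
        have "block_unit m k n i a b \<in> carrier_mat (block_dim m k n) (block_dim m k n)"
          using block_unit_in_algebra block_algebra_carrier by blast
        then have "ntrace_inner ?L (block_unit m k n i a b)
            = (\<Sum>v\<in>?B. c v * ntrace_inner v (block_unit m k n i a b))"
          using ntrace_inner_lincomb[OF _ B(1)] by blast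
        also have "\<dots> = (\<Sum>j<N. g j * ntrace_inner (U j) (block_unit m k n i a b))"
          by (subst sum.reindex[OF inj], intro sum.cong) (auto simp: c_def the_inv_into_f_f[OF inj])
        finally show ?thesis using g[OF that] by simp
      qed
      from A obtain x where x: "A = block_sum m k x" "\<And>i. i < m \<Longrightarrow> x i \<in> carrier_mat (n i) (n i)"
        unfolding block_algebra_eq by blast
      from L obtain y where y: "?L = block_sum m k y" "\<And>i. i < m \<Longrightarrow> y i \<in> carrier_mat (n i) (n i)"
        unfolding block_algebra_eq by blast
      have "y i = x i" if "i < m" for i
        by (rule block_sum_coord_eqI[OF y(2) x(2) k d _ that]) (use coord that x y in simp_all)
      then have "?L = A" unfolding x y by (rule block_sum_cong)
      then show "A \<in> V.span ?B" unfolding V.span_def by (force simp: class_ring_simps)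
    qed
  qed
  ultimately show "V.basis ?B" using B carr by (simp add: V.basis_def)
qed

definition fourier_unitary :: "nat \<Rightarrow> (nat \<Rightarrow> nat) \<Rightarrow> (nat \<Rightarrow> nat) \<Rightarrow> nat \<Rightarrow> complex mat" where
  "fourier_unitary m k n j = block_sum m k
     (\<lambda>i. twisted_fourier (n i) (square_offset n m) (square_offset n i) j)"

text \<open>The Fourier phases \<open>root_unity r ^ (a * b)\<close> do not depend on \<open>j\<close> and cancel, so that only the
  characters of the cyclic group of order \<open>N\<close> remain.\<close>
lemma twisted_fourier_entry_prod:
  assumes "a < r" "b < r"
  shows "twisted_fourier r N t j $$ (a, b) * cnj (twisted_fourier r N t l $$ (a, b))
    = root_unity N ^ (j * (t + r * a + b)) * cnj (root_unity N ^ (l * (t + r * a + b))) / of_nat r"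
proof -
  have alg: "(w * p / s) * cnj (w * q / s) = (w * cnj w) * (p * cnj q) / (s * cnj s)"
    for w p q s :: complex by (simp add: mult_ac)
  have sq: "complex_of_real (sqrt (real r)) * complex_of_real (sqrt (real r)) = of_nat r"
    by (simp flip: of_real_mult)
  have entry: "twisted_fourier r N t j $$ (a, b)
      = root_unity r ^ (a * b) * root_unity N ^ (j * (t + r * a + b)) / of_real (sqrt (real r))" for j
    using assms by (simp add: twisted_fourier_def)
  show ?thesis
    by (simp only: entry alg complex_cnj_complex_of_real sq root_unity_mult_cnj mult_1_left)
qed

text \<open>Proportionality enters here: the weight \<open>k i\<close> of the trace and the normalisation \<open>1 / n i\<close> of the
  entries combine to \<open>1 / c\<close> in every block. All \<open>N\<close> entries then have the same weight, and the inner
  product is a multiple of that of two distinct characters.\<close>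
lemma fourier_unitary_orthogonal:
  assumes c: "\<And>i. i < m \<Longrightarrow> real (n i) = c * real (k i)" and n: "\<And>i. i < m \<Longrightarrow> n i > 0"
    and jl: "j < square_offset n m" "l < square_offset n m" "j \<noteq> l"
  shows "ntrace_inner (fourier_unitary m k n j) (fourier_unitary m k n l) = 0"
proof -
  let ?N = "square_offset n m"
  let ?w = "\<lambda>s. root_unity ?N ^ (j * s) * cnj (root_unity ?N ^ (l * s))"
  have weight: "complex_of_nat (k i) / of_nat (n i) = of_real (1 / c)" if "i < m" for i
  proof -
    have "c \<noteq> 0" "k i \<noteq> 0"
      using c[OF that] n[OF that] by (cases "k i = 0"; auto)+
    then have "real (k i) / real (n i) = 1 / c" using c[OF that] by (simp add: field_simps)
    then show ?thesis by (metis of_real_divide of_real_of_nat_eq)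
  qed
  have "(\<Sum>i<m. of_nat (k i) * (\<Sum>a<n i. \<Sum>b<n i.
        twisted_fourier (n i) ?N (square_offset n i) j $$ (a, b)
        * cnj (twisted_fourier (n i) ?N (square_offset n i) l $$ (a, b))))
      = (\<Sum>i<m. of_nat (k i) * (\<Sum>a<n i. \<Sum>b<n i. ?w (block_index n i a b) / of_nat (n i)))"
    by (intro sum.cong refl arg_cong2[of _ _ _ _ "(*)"] twisted_fourier_entry_prod) auto
  also have "\<dots> = (\<Sum>i<m. (of_nat (k i) / of_nat (n i)) * (\<Sum>a<n i. \<Sum>b<n i. ?w (block_index n i a b)))"
    by (simp add: sum_divide_distrib[symmetric])
  also have "\<dots> = (\<Sum>i<m. of_real (1 / c) * (\<Sum>a<n i. \<Sum>b<n i. ?w (block_index n i a b)))"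
    by (intro sum.cong refl) (simp only: weight lessThan_iff)
  also have "\<dots> = of_real (1 / c) * (\<Sum>s<?N. ?w s)"
    by (simp only: sum_distrib_left[symmetric] sum_block_index[of ?w])
  also have "\<dots> = 0" using jl by (simp only: root_unity_orthogonal[OF jl(1,2)]) simp
  finally show ?thesis
    unfolding fourier_unitary_def by (subst ntrace_inner_block_sum[where n = n]) auto
qed

text \<open>Up to a nonzero factor depending on the entry only, the entry numbered \<open>s\<close> of the \<open>j\<close>-th unitary is
  \<open>\<omega> ^ (j * s)\<close>. Expanding \<open>A\<close> in this family therefore means inverting a discrete Fourier transform
  of length \<open>N\<close>.\<close>
lemma fourier_unitary_complete:
  assumes A: "A \<in> block_algebra m k n"
  shows "\<exists>g. \<forall>i a b. i < m \<longrightarrow> a < n i \<longrightarrow> b < n i \<longrightarrow>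
    ntrace_inner A (block_unit m k n i a b)
    = (\<Sum>j<square_offset n m. g j * ntrace_inner (fourier_unitary m k n j) (block_unit m k n i a b))"
proof -
  let ?N = "square_offset n m"
  let ?I = "SIGMA i:{..<m}. {..<n i} \<times> {..<n i}" and ?f = "\<lambda>(i, a, b). block_index n i a b"
  from A obtain x where Ax: "A = block_sum m k x" and x: "\<And>i. i < m \<Longrightarrow> x i \<in> carrier_mat (n i) (n i)"
    unfolding block_algebra_eq by blast
  \<comment> \<open>The entries of A divided by the factors w ^ (a * b) / sqrt (n i) of the unitaries;
    y lists the same values by entry number and g is its inverse transform.\<close>
  define h where "h = (\<lambda>(i, a, b). of_real (sqrt (real (n i))) * x i $$ (a, b) * cnj (root_unity (n i) ^ (a * b)))"
  define y where "y s = h (the_inv_into ?I ?f s)" for s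
  have y: "y (block_index n i a b) = h (i, a, b)" if "i < m" "a < n i" "b < n i" for i a b
    using the_inv_into_f_f[OF bij_betw_imp_inj_on[OF bij_betw_block_index[of n m]], of "(i, a, b)"] that
    by (simp add: y_def)
  define g where "g j = (\<Sum>s<?N. y s * cnj (root_unity ?N ^ (j * s))) / of_nat ?N" for j
  have inversion: "(\<Sum>j<?N. g j * root_unity ?N ^ (j * t)) = y t" if t: "t < ?N" for t
  proof -
    have "(\<Sum>j<?N. g j * root_unity ?N ^ (j * t))
        = (\<Sum>j<?N. \<Sum>s<?N. y s / of_nat ?N * (root_unity ?N ^ (t * j) * cnj (root_unity ?N ^ (s * j))))"
      by (intro sum.cong refl)
         (simp add: g_def sum_divide_distrib sum_distrib_right sum_distrib_left mult_ac)
    also have "\<dots> = (\<Sum>s<?N. \<Sum>j<?N. y s / of_nat ?N * (root_unity ?N ^ (t * j) * cnj (root_unity ?N ^ (s * j))))"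
      by (rule sum.swap)
    also have "\<dots> = (\<Sum>s<?N. y s / of_nat ?N * (if t = s then of_nat ?N else 0))"
      by (intro sum.cong refl, subst sum_distrib_left[symmetric], subst root_unity_orthogonal) (use t in auto)
    also have "\<dots> = (\<Sum>s<?N. if s = t then y t else 0)"
      using t by (intro sum.cong refl) auto
    finally show ?thesis using t by (simp add: sum.delta)
  qed
  have "ntrace_inner A (block_unit m k n i a b)
      = (\<Sum>j<?N. g j * ntrace_inner (fourier_unitary m k n j) (block_unit m k n i a b))"
    if i: "i < m" and a: "a < n i" and b: "b < n i" for i a b
  proof -
    let ?u = "\<lambda>j. twisted_fourier (n i) ?N (square_offset n i) j $$ (a, b)"
    let ?p = "root_unity (n i) ^ (a * b)" and ?s = "complex_of_real (sqrt (real (n i)))"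
    have s0: "?s \<noteq> 0" using a by simp
    have t: "block_index n i a b < ?N"
      using block_index_less[of a n i b, OF a b] square_offset_mono[of "Suc i" m n] i by simp
    have "(\<Sum>j<?N. g j * ?u j) = (\<Sum>j<?N. (?p / ?s) * (g j * root_unity ?N ^ (j * block_index n i a b)))"
      using a b by (intro sum.cong refl) (simp add: twisted_fourier_def)
    also have "\<dots> = (?p / ?s) * y (block_index n i a b)"
      by (simp only: sum_distrib_left[symmetric] inversion[OF t])
    also have "\<dots> = (?p * cnj ?p) * x i $$ (a, b)"
      unfolding y[OF i a b] h_def prod.case using s0 by (simp add: mult_ac)
    also have "\<dots> = x i $$ (a, b)"
      by (simp only: root_unity_mult_cnj mult_1_left)
    finally have coord: "(\<Sum>j<?N. g j * ?u j) = x i $$ (a, b)" .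
    have ip: "ntrace_inner (fourier_unitary m k n j) (block_unit m k n i a b)
        = of_nat (k i) / of_nat (block_dim m k n) * ?u j" for j
      unfolding fourier_unitary_def by (subst ntrace_inner_block_unit[where n = n]) (use i a b in auto)
    have "(\<Sum>j<?N. g j * ntrace_inner (fourier_unitary m k n j) (block_unit m k n i a b))
        = of_nat (k i) / of_nat (block_dim m k n) * (\<Sum>j<?N. g j * ?u j)"
      unfolding ip sum_distrib_left by (intro sum.cong refl) (simp only: mult.left_commute)
    also have "\<dots> = ntrace_inner A (block_unit m k n i a b)"
      unfolding coord Ax using ntrace_inner_block_unit[of m x n i a b k, OF x i a b] by simp
    finally show ?thesis by simp
  qed
  then show ?thesis by blast
qed

theorem theorem2p4:
  fixes m :: nat and k n :: "nat \<Rightarrow> nat"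
  assumes "m \<ge> 1"
    and "\<And>i. i < m \<Longrightarrow> k i > 0"
    and "\<And>i. i < m \<Longrightarrow> n i > 0"
  shows "(\<exists>B. vectorspace.basis class_ring (block_space m k n) B
            \<and> (\<forall>U\<in>B. unitary_mat U)
            \<and> pairwise (\<lambda>U V. ntrace_inner U V = 0) B)
     \<longleftrightarrow> (\<exists>c::real. \<forall>i<m. real (n i) = c * real (k i))"
proof
  assume "\<exists>B. vectorspace.basis class_ring (block_space m k n) B
            \<and> (\<forall>U\<in>B. unitary_mat U) \<and> pairwise (\<lambda>U V. ntrace_inner U V = 0) B"
  then show "\<exists>c::real. \<forall>i<m. real (n i) = c * real (k i)"
    using proportional_if_unitary_basis[of m k n, OF assms] by blast
next
  assume "\<exists>c::real. \<forall>i<m. real (n i) = c * real (k i)"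
  then obtain c :: real where c: "\<And>i. i < m \<Longrightarrow> real (n i) = c * real (k i)" by blast
  let ?U = "fourier_unitary m k n"
  let ?B = "?U ` {..<square_offset n m}"
  have alg: "?U j \<in> block_algebra m k n" for j
    unfolding fourier_unitary_def by (rule block_sum_in_algebra) simp
  have unitary: "unitary_mat (?U j)" for j
    unfolding fourier_unitary_def
    by (rule unitary_block_sumI[where n = n]) (simp_all add: twisted_fourier_unitary)
  have orth: "ntrace_inner (?U j) (?U l) = 0"
    if "j < square_offset n m" "l < square_offset n m" "j \<noteq> l" for j l
    using c assms(3) that by (rule fourier_unitary_orthogonal)
  have d: "block_dim m k n > 0" using assms by (rule block_dim_pos)
  note basis = unitary_basis_of_orthogonal_family[where U = ?U and N = "square_offset n m" and k = k,
      OF d alg unitary orth fourier_unitary_complete assms(2)]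
  show "\<exists>B. vectorspace.basis class_ring (block_space m k n) B
            \<and> (\<forall>U\<in>B. unitary_mat U) \<and> pairwise (\<lambda>U V. ntrace_inner U V = 0) B"
    using basis unitary by (intro exI[of _ ?B]) blast
qed

end
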